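(* Let $q,h,k$ be positive integers with $h\geq 2$ and $h\le q/2$. For the graph $L_{q,h,k}$ we have $$ABC(L_{q,h,k})=\frac{2(k-1)}{3}+\frac{qk}{\sqrt{2}}.$$
   Context: For a finite simple graph $G$, $ABC(G)=\sum_{uv\in E(G)}\sqrt{\frac{d_u+d_v-2}{d_ud_v}}$, where $d_u$ is the degree of $u$ in $G$ (atom-bond connectivity index). The graph $L_{q,h,k}$ is the link of $k$ cycles $C_q$ in which the distance between the two contact vertices in the same cycle is $h$: take $k$ disjoint copies $C^{(1)},\ldots,C^{(k)}$ of the cycle $C_q$, in each $C^{(i)}$ choose vertices $x_i,y_i$ at distance $h$, and add the edge $y_ix_{i+1}$ for each $i=1,\ldots,k-1$. *)

theory Defs
  imports Complex_Main "HOL-Library.Extended_Nat" "HOL-Library.Disjoint_Sets"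
begin

text \<open>Undirected graphs: an edge is the set of its two end vertices.\<close>

record 'a ugraph =
  verts :: "'a set"
  edges :: "'a set set"

definition fin_simple_graph :: "'a ugraph \<Rightarrow> bool" where
  "fin_simple_graph G \<longleftrightarrow> finite (verts G) \<and> (\<forall>e\<in>edges G. e \<subseteq> verts G \<and> card e = 2)"

definition degree :: "'a ugraph \<Rightarrow> 'a \<Rightarrow> nat" where
  "degree G u = card {e \<in> edges G. u \<in> e}"

text \<open>For an edge \<open>e = {u, v}\<close> with \<open>u \<noteq> v\<close> the sum and the product over \<open>e\<close> are
  \<open>d\<^sub>u + d\<^sub>v\<close> and \<open>d\<^sub>u d\<^sub>v\<close>; each undirected edge contributes once.\<close>

definition ABC :: "'a ugraph \<Rightarrow> real" where
  "ABC G = (\<Sum>e\<in>edges G.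
     sqrt (((\<Sum>u\<in>e. real (degree G u)) - 2) / (\<Prod>u\<in>e. real (degree G u))))"

definition adj :: "'a ugraph \<Rightarrow> 'a rel" where
  "adj G = {(u, v). {u, v} \<in> edges G}"

text \<open>Length of a shortest walk; \<open>\<infinity>\<close> if there is none.\<close>

definition gdist :: "'a ugraph \<Rightarrow> 'a \<Rightarrow> 'a \<Rightarrow> enat" where
  "gdist G u v = (INF n\<in>{n. (u, v) \<in> adj G ^^ n}. enat n)"

definition isomorphic :: "'a ugraph \<Rightarrow> 'b ugraph \<Rightarrow> bool" where
  "isomorphic G H \<longleftrightarrow>
     (\<exists>f. bij_betw f (verts G) (verts H) \<and> edges H = (\<lambda>e. f ` e) ` edges G)"

text \<open>This is the simple cycle \<open>C\<^sub>q\<close> for \<open>q \<ge> 3\<close>.\<close>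

definition cycle_graph :: "nat \<Rightarrow> nat ugraph" where
  "cycle_graph q = \<lparr>verts = {..<q}, edges = {{j, Suc j mod q} | j. j < q}\<rparr>"

text \<open>\<open>G\<close> is a realisation of \<open>L\<^bsub>q,h,k\<^esub>\<close>, which is determined only up to isomorphism:
  the copies \<open>C i\<close> of the cycle and the contact vertices \<open>x i\<close>, \<open>y i\<close> are arbitrary.\<close>

definition is_link :: "nat \<Rightarrow> nat \<Rightarrow> nat \<Rightarrow> 'a ugraph \<Rightarrow> bool" where
  "is_link q h k G \<longleftrightarrow>
     (\<exists>(C :: nat \<Rightarrow> 'a ugraph) x y.
        (\<forall>i\<in>{1..k}. isomorphic (cycle_graph q) (C i) \<and>
           x i \<in> verts (C i) \<and> y i \<in> verts (C i) \<and> gdist (C i) (x i) (y i) = enat h) \<and>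
        disjoint_family_on (\<lambda>i. verts (C i)) {1..k} \<and>
        verts G = (\<Union>i\<in>{1..k}. verts (C i)) \<and>
        edges G = (\<Union>i\<in>{1..k}. edges (C i)) \<union> {{y i, x (Suc i)} | i. i \<in> {1..<k}})"

text \<open>Sanity checks: realisations exist, and they are finite simple graphs.\<close>

lemma is_link_exists:
  assumes "2 \<le> h" "2 * h \<le> q"
  shows "\<exists>G :: (nat \<times> nat) ugraph. is_link q h k G"
proof -
  define C where "C i = \<lparr>verts = Pair i ` {..<q}, edges = (\<lambda>e. Pair i ` e) ` edges (cycle_graph q)\<rparr>"
    for i :: nat
  have iso: "isomorphic (cycle_graph q) (C i)" for i
    unfolding isomorphic_def C_def
    by (rule exI[of _ "Pair i"]) (auto simp: cycle_graph_def bij_betw_def inj_on_def)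
  have adjC: "adj (C i) = {((i, a), (i, b)) | a b. a < q \<and> b = Suc a mod q \<or> b < q \<and> a = Suc b mod q}" for i
  proof -
    have "edges (cycle_graph q) = (\<lambda>j. {j, Suc j mod q}) ` {..<q}"
      by (auto simp: cycle_graph_def)
    then have E: "edges (C i) = (\<lambda>j. {(i, j), (i, Suc j mod q)}) ` {..<q}"
      by (simp add: C_def image_image)
    show ?thesis by (intro set_eqI) (auto simp: adj_def E image_iff doubleton_eq_iff)
  qed
  define p where "p = (\<lambda>(i :: nat, j). min j (q - j))"
  have step: "p v \<le> Suc (p u)" if "(u, v) \<in> adj (C i)" for u v i
    using that assms by (auto simp: adjC p_def mod_Suc split: if_splits)
  have lower: "p v \<le> p u + n" if "(u, v) \<in> adj (C i) ^^ n" for u v i n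
    using that
  proof (induction n arbitrary: v)
    case (Suc n)
    then obtain w where "(u, w) \<in> adj (C i) ^^ n" "(w, v) \<in> adj (C i)" by auto
    then have "p w \<le> p u + n" "p v \<le> Suc (p w)" using Suc.IH step by blast+
    then show ?case by simp
  qed simp
  have upper: "((i, 0), (i, j)) \<in> adj (C i) ^^ j" if "j < q" for i j
    using that by (induction j) (auto simp: adjC)
  have "gdist (C i) (i, 0) (i, h) = enat h" for i
    unfolding gdist_def
  proof (rule antisym)
    show "(INF n\<in>{n. ((i, 0), (i, h)) \<in> adj (C i) ^^ n}. enat n) \<le> enat h"
      using upper[of h i] assms by (intro INF_lower) auto
    show "enat h \<le> (INF n\<in>{n. ((i, 0), (i, h)) \<in> adj (C i) ^^ n}. enat n)"
    proof (rule INF_greatest)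
      fix n assume "n \<in> {n. ((i, 0), (i, h)) \<in> adj (C i) ^^ n}"
      then have "p (i, h) \<le> p (i, 0) + n" using lower by blast
      then show "enat h \<le> enat n" using assms by (simp add: p_def)
    qed
  qed
  moreover have "disjoint_family_on (\<lambda>i. verts (C i)) {1..k}"
    by (auto simp: disjoint_family_on_def C_def)
  ultimately have "is_link q h k \<lparr>verts = (\<Union>i\<in>{1..k}. verts (C i)),
      edges = (\<Union>i\<in>{1..k}. edges (C i)) \<union> {{(i, h), (Suc i, 0)} | i. i \<in> {1..<k}}\<rparr>"
    unfolding is_link_def using iso assms
    by (intro exI[of _ C] exI[of _ "\<lambda>i. (i, 0)"] exI[of _ "\<lambda>i. (i, h)"]) (auto simp: C_def)
  then show ?thesis by blast
qed

lemma is_link_simple: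
  assumes "is_link q h k G" "3 \<le> q"
  shows "fin_simple_graph G"
proof -
  obtain C x y where
    C: "\<forall>i\<in>{1..k}. isomorphic (cycle_graph q) (C i) \<and>
           x i \<in> verts (C i) \<and> y i \<in> verts (C i) \<and> gdist (C i) (x i) (y i) = enat h" and
    dj: "disjoint_family_on (\<lambda>i. verts (C i)) {1..k}" and
    V: "verts G = (\<Union>i\<in>{1..k}. verts (C i))" and
    E: "edges G = (\<Union>i\<in>{1..k}. edges (C i)) \<union> {{y i, x (Suc i)} | i. i \<in> {1..<k}}"
    using assms(1) unfolding is_link_def by (elim exE conjE) (rule that)
  have iso: "isomorphic (cycle_graph q) (C i)" and xy: "x i \<in> verts (C i) \<and> y i \<in> verts (C i)"
    if "i \<in> {1..k}" for i using C that by blast+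
  have cyc: "e \<subseteq> {..<q} \<and> card e = 2" if "e \<in> edges (cycle_graph q)" for e
    using that assms(2) by (auto simp: cycle_graph_def mod_Suc card_insert_if)
  have fin: "finite (verts (C i)) \<and> (\<forall>e\<in>edges (C i). e \<subseteq> verts (C i) \<and> card e = 2)"
    if i: "i \<in> {1..k}" for i
  proof -
    obtain f where f: "bij_betw f {..<q} (verts (C i))"
      "edges (C i) = (\<lambda>e. f ` e) ` edges (cycle_graph q)"
      using iso[OF i] by (auto simp: isomorphic_def cycle_graph_def)
    have "finite (verts (C i))" using f(1) bij_betw_finite by blast
    moreover have "f ` e \<subseteq> verts (C i) \<and> card (f ` e) = 2" if "e \<in> edges (cycle_graph q)" for e
      using cyc[OF that] f(1) by (metis bij_betw_def card_image image_mono inj_on_subset)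
    ultimately show ?thesis using f(2) by auto
  qed
  have "{y i, x (Suc i)} \<subseteq> verts G \<and> card {y i, x (Suc i)} = 2" if "i \<in> {1..<k}" for i
  proof -
    have "i \<in> {1..k}" "Suc i \<in> {1..k}" using that by auto
    moreover from this have "verts (C i) \<inter> verts (C (Suc i)) = {}"
      using dj by (auto simp: disjoint_family_on_def)
    ultimately show ?thesis using xy[of i] xy[of "Suc i"] V
      by (auto simp: card_insert_if)
  qed
  with fin have "\<forall>e\<in>edges G. e \<subseteq> verts G \<and> card e = 2"
    unfolding E using V by blast
  moreover have "finite (verts G)" unfolding V using fin by blast
  ultimately show ?thesis by (simp add: fin_simple_graph_def)
qed

end

theory Submission
  imports Defs
begin

text \<open>
  The index depends only on the degrees at the two ends of each edge, and two features of the
  weight \<open>sqrt ((a + b - 2) / (a b))\<close> make it computable here. If \<open>a = 2\<close>, the weight is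
  \<open>1 / sqrt 2\<close> for every positive \<open>b\<close>; if \<open>a = b = 3\<close>, it is \<open>2 / 3\<close>.

  In the link every vertex has degree 2 inside its own cycle, and a linking edge adds 1 at each of
  its ends (\<open>degree_link\<close>). As \<open>h \<ge> 2\<close>, the two contact vertices of a cycle are distinct and not
  adjacent. Distinctness gives every end of a linking edge degree exactly 3, and non-adjacency
  leaves every edge of a cycle an end that is not a contact vertex, which therefore has degree 2.
  Thus the \<open>q k\<close> cycle edges weigh \<open>1 / sqrt 2\<close> each, and the \<open>k - 1\<close> linking edges weigh
  \<open>2 / 3\<close> each.
\<close>

section \<open>Degrees and edge counts of cycles and their isomorphic copies\<close>

text \<open>For \<open>q = 2\<close> the indices 0 and 1 would name the same edge.\<close>

lemma inj_on_cycle_edge: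
  assumes "3 \<le> q"
  shows "inj_on (\<lambda>j. {j, Suc j mod q}) {..<q}"
  using assms by (auto simp: inj_on_def doubleton_eq_iff mod_Suc split: if_splits)

lemma edges_cycle_graph: "edges (cycle_graph q) = (\<lambda>j. {j, Suc j mod q}) ` {..<q}"
  by (auto simp: cycle_graph_def)

lemma verts_cycle_graph: "verts (cycle_graph q) = {..<q}"
  by (simp add: cycle_graph_def)

lemma card_edges_cycle_graph: "3 \<le> q \<Longrightarrow> card (edges (cycle_graph q)) = q"
  by (simp add: edges_cycle_graph card_image inj_on_cycle_edge)

lemma cycle_graph_simple: "3 \<le> q \<Longrightarrow> fin_simple_graph (cycle_graph q)"
  by (auto simp: fin_simple_graph_def cycle_graph_def mod_Suc card_insert_if)

lemma degree_cycle_graph: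
  assumes "3 \<le> q" "u < q"
  shows "degree (cycle_graph q) u = 2"
proof -
  \<comment> \<open>The predecessor of \<open>u\<close> on the cycle.\<close>
  define p where "p = (if u = 0 then q - 1 else u - 1)"
  have p: "p < q" "Suc p mod q = u" "p \<noteq> u"
    using assms by (auto simp: p_def)
  have "Suc j mod q = u \<longleftrightarrow> j = p" if "j < q" for j
    using assms that by (auto simp: p_def mod_Suc)
  then have "{e \<in> edges (cycle_graph q). u \<in> e} = (\<lambda>j. {j, Suc j mod q}) ` {u, p}"
    using p assms(2) by (auto simp: edges_cycle_graph)
  moreover have "inj_on (\<lambda>j. {j, Suc j mod q}) {u, p}"
    by (rule inj_on_subset[OF inj_on_cycle_edge[OF assms(1)]]) (use p assms(2) in auto)
  ultimately show ?thesis
    using p(3) by (simp add: degree_def card_image)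
qed

lemma isomorphic_card_edges:
  assumes "isomorphic G H" "fin_simple_graph G"
  shows "card (edges H) = card (edges G)"
proof -
  obtain f where f: "inj_on f (verts G)" "edges H = (`) f ` edges G"
    using assms(1) by (auto simp: isomorphic_def bij_betw_def)
  have "edges G \<subseteq> Pow (verts G)"
    using assms(2) by (auto simp: fin_simple_graph_def)
  then have "inj_on ((`) f) (edges G)"
    using inj_on_image_Pow[OF f(1)] inj_on_subset by blast
  then show ?thesis
    by (simp add: f(2) card_image)
qed

lemma isomorphic_simple:
  assumes "isomorphic G H" "fin_simple_graph G"
  shows "fin_simple_graph H"
proof -
  obtain f where f: "inj_on f (verts G)" "verts H = f ` verts G" "edges H = (`) f ` edges G"
    using assms(1) by (auto simp: isomorphic_def bij_betw_def)
  have "f ` e \<subseteq> verts H \<and> card (f ` e) = 2" if "e \<in> edges G" for e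
    using assms(2) that f(1,2) by (metis card_image fin_simple_graph_def image_mono inj_on_subset)
  then show ?thesis
    using assms(2) f(2,3) by (auto simp: fin_simple_graph_def)
qed

lemma isomorphic_regular:
  assumes "isomorphic G H" "fin_simple_graph G"
    and "\<And>u. u \<in> verts G \<Longrightarrow> degree G u = d" and "v \<in> verts H"
  shows "degree H v = d"
proof -
  obtain f where f: "inj_on f (verts G)" "verts H = f ` verts G" "edges H = (`) f ` edges G"
    using assms(1) by (auto simp: isomorphic_def bij_betw_def)
  then obtain u where u: "u \<in> verts G" "v = f u"
    using assms(4) by blast
  have sub: "edges G \<subseteq> Pow (verts G)"
    using assms(2) by (auto simp: fin_simple_graph_def)
  have "f u \<in> f ` e \<longleftrightarrow> u \<in> e" if "e \<in> edges G" for e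
    using inj_on_image_mem_iff[OF f(1) u(1)] sub that by blast
  then have "{e \<in> edges H. v \<in> e} = (`) f ` {e \<in> edges G. u \<in> e}"
    unfolding f(3) u(2) by auto
  moreover have "inj_on ((`) f) {e \<in> edges G. u \<in> e}"
    by (rule inj_on_subset[OF inj_on_image_Pow[OF f(1)]]) (use sub in auto)
  ultimately show ?thesis
    using assms(3)[OF u(1)] by (simp add: degree_def card_image)
qed

section \<open>Vertices at distance at least two\<close>

lemma gdist_le: "(u, v) \<in> adj G ^^ n \<Longrightarrow> gdist G u v \<le> enat n"
  unfolding gdist_def by (rule INF_lower) simp

lemma far_imp_distinct_nonadjacent:
  assumes "gdist G u v = enat h" "2 \<le> h"
  shows "u \<noteq> v" "{u, v} \<notin> edges G"
proof -
  show "u \<noteq> v"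
    using gdist_le[of u v 0 G] assms by auto
  show "{u, v} \<notin> edges G"
    using gdist_le[of u v 1 G] assms by (auto simp: adj_def)
qed

section \<open>Edge weights\<close>

definition abc_weight :: "'a ugraph \<Rightarrow> 'a set \<Rightarrow> real" where
  "abc_weight G e = sqrt (((\<Sum>u\<in>e. real (degree G u)) - 2) / (\<Prod>u\<in>e. real (degree G u)))"

text \<open>The degree of the other end cancels: \<open>(2 + b - 2) / (2 b) = 1 / 2\<close>.\<close>

lemma abc_weight_degree_2:
  assumes "u \<noteq> v" "degree G u = 2" "degree G v > 0"
  shows "abc_weight G {u, v} = 1 / sqrt 2"
  using assms by (simp add: abc_weight_def real_sqrt_divide)

lemma abc_weight_degree_3:
  assumes "u \<noteq> v" "degree G u = 3" "degree G v = 3"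
  shows "abc_weight G {u, v} = 2 / 3"
proof -
  have "abc_weight G {u, v} = sqrt ((2 / 3)\<^sup>2)"
    using assms by (simp add: abc_weight_def power2_eq_square)
  then show ?thesis
    by simp
qed

section \<open>Linked cycles\<close>

text \<open>A fixed choice of cycles and contact vertices. The distance of the contact vertices matters
  only through its consequence that they are distinct and not adjacent.\<close>

locale linked_cycles =
  fixes q k :: nat and C :: "nat \<Rightarrow> 'a ugraph" and x y :: "nat \<Rightarrow> 'a" and G :: "'a ugraph"
  assumes q: "3 \<le> q"
    and cycle: "i \<in> {1..k} \<Longrightarrow> isomorphic (cycle_graph q) (C i)"
    and contact: "i \<in> {1..k} \<Longrightarrow> x i \<in> verts (C i)" "i \<in> {1..k} \<Longrightarrow> y i \<in> verts (C i)"
    and distinct: "i \<in> {1..k} \<Longrightarrow> x i \<noteq> y i"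
    and nonadjacent: "i \<in> {1..k} \<Longrightarrow> {x i, y i} \<notin> edges (C i)"
    and disjoint: "disjoint_family_on (\<lambda>i. verts (C i)) {1..k}"
    and edges_G: "edges G = (\<Union>i\<in>{1..k}. edges (C i)) \<union> {{y i, x (Suc i)} | i. i \<in> {1..<k}}"
begin

definition links :: "'a set set" where
  "links = (\<lambda>i. {y i, x (Suc i)}) ` {1..<k}"

lemma edges_link: "edges G = (\<Union>i\<in>{1..k}. edges (C i)) \<union> links"
  by (auto simp: edges_G links_def)

lemma cycle_simple: "i \<in> {1..k} \<Longrightarrow> fin_simple_graph (C i)"
  using cycle cycle_graph_simple isomorphic_simple q by blast

lemma card_edges_cycle: "i \<in> {1..k} \<Longrightarrow> card (edges (C i)) = q"
  using cycle cycle_graph_simple isomorphic_card_edges card_edges_cycle_graph q by metis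

lemma degree_cycle: "i \<in> {1..k} \<Longrightarrow> u \<in> verts (C i) \<Longrightarrow> degree (C i) u = 2"
  by (rule isomorphic_regular[OF cycle cycle_graph_simple[OF q]])
    (simp_all add: verts_cycle_graph degree_cycle_graph q)

lemma edge_in_cycle:
  assumes "i \<in> {1..k}" "e \<in> edges (C i)"
  shows "e \<subseteq> verts (C i)" "card e = 2"
  using cycle_simple[OF assms(1)] assms(2) by (auto simp: fin_simple_graph_def)

lemma finite_edges_cycle: "i \<in> {1..k} \<Longrightarrow> finite (edges (C i))"
  using card_edges_cycle q by (metis card.infinite not_numeral_le_zero)

lemma same_cycle:
  assumes "i \<in> {1..k}" "j \<in> {1..k}" "u \<in> verts (C i)" "u \<in> verts (C j)"
  shows "i = j"
  using disjoint assms unfolding disjoint_family_on_def by blast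

lemma y_in_cycle_iff:
  assumes "i \<in> {1..k}" "j \<in> {1..k}"
  shows "y j \<in> verts (C i) \<longleftrightarrow> j = i"
  using same_cycle[OF assms(2,1)] contact(2) assms by blast

lemma x_in_cycle_iff:
  assumes "i \<in> {1..k}" "j \<in> {1..k}"
  shows "x j \<in> verts (C i) \<longleftrightarrow> j = i"
  using same_cycle[OF assms(2,1)] contact(1) assms by blast

lemma link_not_in_cycle:
  assumes "j \<in> {1..<k}" "i \<in> {1..k}"
  shows "{y j, x (Suc j)} \<notin> edges (C i)"
  using assms edge_in_cycle(1)[OF assms(2), of "{y j, x (Suc j)}"]
    y_in_cycle_iff[OF assms(2), of j] x_in_cycle_iff[OF assms(2), of "Suc j"] by auto

text \<open>A link goes from one cycle to the next, so its two ends tell which link it is.\<close>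

lemma inj_on_link: "inj_on (\<lambda>i. {y i, x (Suc i)}) {1..<k}"
proof (rule inj_onI)
  fix i j assume ij: "i \<in> {1..<k}" "j \<in> {1..<k}" and eq: "{y i, x (Suc i)} = {y j, x (Suc j)}"
  have end_of_link: "b = a \<or> Suc b = a"
    if "a \<in> {1..<k}" "b \<in> {1..<k}" "y a = y b \<or> y a = x (Suc b)" for a b
    using that contact(2)[of a] y_in_cycle_iff[of a b] x_in_cycle_iff[of a "Suc b"] by auto
  have "j = i \<or> Suc j = i"
    using end_of_link[OF ij] eq by (auto simp: doubleton_eq_iff)
  moreover have "i = j \<or> Suc i = j"
    using end_of_link[OF ij(2,1)] eq by (auto simp: doubleton_eq_iff)
  ultimately show "i = j"
    by auto
qed

text \<open>A vertex of the \<open>i\<close>-th cycle can only be met by the outgoing link \<open>i\<close>, at \<open>y i\<close>, and by the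
  incoming link \<open>i - 1\<close>, at \<open>x i\<close>. The first cycle has no incoming and the last one no outgoing
  link.\<close>

lemma degree_link:
  assumes i: "i \<in> {1..k}" and u: "u \<in> verts (C i)"
  shows "degree G u = 2 + of_bool (u = y i \<and> i < k) + of_bool (u = x i \<and> 1 < i)"
proof -
  define N where "N = {j \<in> {1..<k}. u \<in> {y j, x (Suc j)}}"
  define out inc where "out = (u = y i)" and "inc = (u = x i)"
  have "u = y j \<longleftrightarrow> j = i \<and> out" if "j \<in> {1..<k}" for j
    using y_in_cycle_iff[OF i, of j] u that by (auto simp: out_def)
  moreover have "u = x (Suc j) \<longleftrightarrow> Suc j = i \<and> inc" if "j \<in> {1..<k}" for j
    using x_in_cycle_iff[OF i, of "Suc j"] u that by (auto simp: inc_def)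
  ultimately have "N = {j \<in> {1..<k}. j = i \<and> out \<or> Suc j = i \<and> inc}"
    unfolding N_def by blast
  also have "\<dots> = (if out \<and> i < k then {i} else {}) \<union> (if inc \<and> 1 < i then {i - 1} else {})"
    using i by auto
  finally have N: "N = \<dots>" .
  have "j = i" if "j \<in> {1..k}" "e \<in> edges (C j)" "u \<in> e" for j e
    using edge_in_cycle(1)[OF that(1,2)] same_cycle[OF that(1) i _ u] that(3) by blast
  then have "{e \<in> (\<Union>j\<in>{1..k}. edges (C j)). u \<in> e} = {e \<in> edges (C i). u \<in> e}"
    using i by blast
  moreover have "{e \<in> links. u \<in> e} = (\<lambda>j. {y j, x (Suc j)}) ` N"
    unfolding links_def N_def by auto
  ultimately have "{e \<in> edges G. u \<in> e} =
      {e \<in> edges (C i). u \<in> e} \<union> (\<lambda>j. {y j, x (Suc j)}) ` N"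
    by (simp only: edges_link Un_iff conj_disj_distribR Collect_disj_eq)
  moreover have "{e \<in> edges (C i). u \<in> e} \<inter> (\<lambda>j. {y j, x (Suc j)}) ` N = {}"
    using link_not_in_cycle i by (auto simp: N_def)
  moreover have "card ((\<lambda>j. {y j, x (Suc j)}) ` N) = card N"
    by (rule card_image, rule inj_on_subset[OF inj_on_link]) (auto simp: N_def)
  moreover have "finite N"
    by (simp add: N_def)
  ultimately have "degree G u = degree (C i) u + card N"
    using finite_edges_cycle[OF i] by (simp add: degree_def card_Un_disjoint)
  moreover have "card N = of_bool (out \<and> i < k) + of_bool (inc \<and> 1 < i)"
    using i unfolding N by auto
  ultimately show ?thesis
    by (simp add: degree_cycle[OF i u] out_def inc_def)
qed

text \<open>The contact vertices are not adjacent, so one end of the edge is not a contact vertex and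
  keeps degree 2.\<close>

lemma weight_cycle_edge:
  assumes i: "i \<in> {1..k}" and e: "e \<in> edges (C i)"
  shows "abc_weight G e = 1 / sqrt 2"
proof -
  obtain u v where uv: "e = {u, v}" "u \<noteq> v"
    using edge_in_cycle(2)[OF i e] by (auto simp: card_2_iff)
  then have in_C: "u \<in> verts (C i)" "v \<in> verts (C i)"
    using edge_in_cycle(1)[OF i e] by auto
  have pos: "degree G w > 0" if "w \<in> verts (C i)" for w
    using degree_link[OF i that] by simp
  have two: "degree G w = 2" if "w \<in> verts (C i)" "w \<notin> {x i, y i}" for w
    using degree_link[OF i that(1)] that(2) by simp
  have "u \<notin> {x i, y i} \<or> v \<notin> {x i, y i}"
    using nonadjacent[OF i] e uv by (auto simp: insert_commute)
  then show ?thesis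
  proof
    assume "u \<notin> {x i, y i}"
    then show ?thesis
      using abc_weight_degree_2[OF uv(2) two pos] in_C uv(1) by simp
  next
    assume "v \<notin> {x i, y i}"
    then show ?thesis
      using abc_weight_degree_2[OF uv(2)[symmetric] two pos] in_C uv(1)
      by (simp add: insert_commute)
  qed
qed

text \<open>As \<open>x i \<noteq> y i\<close>, no vertex is an end of two links, so each end of a link has degree 3.\<close>

lemma weight_link:
  assumes "i \<in> {1..<k}"
  shows "abc_weight G {y i, x (Suc i)} = 2 / 3"
proof (rule abc_weight_degree_3)
  have i: "i \<in> {1..k}" "Suc i \<in> {1..k}"
    using assms by auto
  show "y i \<noteq> x (Suc i)"
    using contact(2)[OF i(1)] x_in_cycle_iff[OF i] by auto
  show "degree G (y i) = 3"
    using degree_link[OF i(1) contact(2)[OF i(1)]] distinct[OF i(1)] assms by simp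
  show "degree G (x (Suc i)) = 3"
    using degree_link[OF i(2) contact(1)[OF i(2)]] distinct[OF i(2)] assms by simp
qed

lemma edges_cycles_disjoint:
  assumes "i \<in> {1..k}" "j \<in> {1..k}" "i \<noteq> j"
  shows "edges (C i) \<inter> edges (C j) = {}"
proof (rule equals0I)
  fix e assume e: "e \<in> edges (C i) \<inter> edges (C j)"
  then obtain u where "u \<in> e"
    using edge_in_cycle(2)[OF assms(1), of e] by (auto simp: card_2_iff)
  then show False
    using e assms edge_in_cycle(1) same_cycle[OF assms(1,2), of u] by blast
qed

lemma ABC_linked_cycles:
  assumes "1 \<le> k"
  shows "ABC G = 2 * (real k - 1) / 3 + real q * real k / sqrt 2"
proof -
  have "ABC G = sum (abc_weight G) (edges G)"
    by (simp add: ABC_def abc_weight_def)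
  also have "\<dots> = sum (abc_weight G) (\<Union>i\<in>{1..k}. edges (C i)) + sum (abc_weight G) links"
    unfolding edges_link
    using finite_edges_cycle link_not_in_cycle
    by (intro sum.union_disjoint) (auto simp: links_def)
  also have "sum (abc_weight G) (\<Union>i\<in>{1..k}. edges (C i)) =
      (\<Sum>i\<in>{1..k}. \<Sum>e\<in>edges (C i). abc_weight G e)"
    using finite_edges_cycle edges_cycles_disjoint by (intro sum.UNION_disjoint) auto
  also have "\<dots> = (\<Sum>i\<in>{1..k}. real q * (1 / sqrt 2))"
    by (rule sum.cong[OF refl]) (simp add: weight_cycle_edge card_edges_cycle)
  also have "sum (abc_weight G) links = (\<Sum>i\<in>{1..<k}. 2 / 3)"
    unfolding links_def sum.reindex[OF inj_on_link] comp_def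
    by (rule sum.cong[OF refl]) (rule weight_link)
  finally show ?thesis
    using assms by (simp add: algebra_simps)
qed

end

section \<open>The atom-bond connectivity index of a link of cycles\<close>

theorem theorem3p10:
  fixes q h k :: nat and G :: "'a ugraph"
  assumes "q \<ge> 1" and "h \<ge> 1" and "k \<ge> 1"
    and "h \<ge> 2" and "real h \<le> real q / 2"
    and "is_link q h k G"
  shows "ABC G = 2 * (real k - 1) / 3 + real q * real k / sqrt 2"
proof -
  obtain C x y where
    C: "\<forall>i\<in>{1..k}. isomorphic (cycle_graph q) (C i) \<and>
          x i \<in> verts (C i) \<and> y i \<in> verts (C i) \<and> gdist (C i) (x i) (y i) = enat h" and
    dj: "disjoint_family_on (\<lambda>i. verts (C i)) {1..k}" and
    E: "edges G = (\<Union>i\<in>{1..k}. edges (C i)) \<union> {{y i, x (Suc i)} | i. i \<in> {1..<k}}"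
    using assms(6) unfolding is_link_def by (elim exE conjE) (rule that)
  interpret linked_cycles q k C x y G
  proof
    show "3 \<le> q"
      using assms(4,5) by linarith
    fix i assume "i \<in> {1..k}"
    then have i: "isomorphic (cycle_graph q) (C i)" "x i \<in> verts (C i)" "y i \<in> verts (C i)"
      "gdist (C i) (x i) (y i) = enat h"
      using C by auto
    show "isomorphic (cycle_graph q) (C i)" "x i \<in> verts (C i)" "y i \<in> verts (C i)"
      by (fact i)+
    show "x i \<noteq> y i" "{x i, y i} \<notin> edges (C i)"
      using far_imp_distinct_nonadjacent[OF i(4) assms(4)] by auto
  qed (fact dj E)+
  show ?thesis
    using ABC_linked_cycles assms(3) by blast
qed

end
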